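(* For every integer $s\ge 7$, one has $$\Pi_{T_s+7}=\{(3,1),(2,2),(1,3)\},$$ and $$|M^{(3,1)}_{T_s+7}|=1,\qquad |M^{(2,2)}_{T_s+7}|=4,\qquad |M^{(1,3)}_{T_s+7}|=1.$$ Hence $|M_{T_s+7}|=6$ and $m^{\mathrm{sc}}_{T_s+7}=0$.
   Context: For an integer $m\ge 0$, $T_m:=m(m+1)/2$. Compressed form: a partition $\lambda$ is written $\lambda=(L_1^{m_1},\dots,L_r^{m_r})$ with $L_1>\cdots>L_r>0$ its distinct part sizes and $m_i\ge 1$ the multiplicity of $L_i$. Gaps: $g_i=L_i-L_{i+1}$ for $1\le i<r$ and $g_r=L_r$. Set $A(\lambda):=\#\{i:g_i>1\}$ and $B(\lambda):=\#\{i:m_i>1\}$. Partition graph: for $n\ge 1$, $G_n$ is the simple graph whose vertices are the integer partitions of $n$; two distinct partitions are adjacent if one is obtained from the other by an elementary transfer of one unit from one part to another (subtract $1$ from one part and add $1$ to another part), followed by reordering. Here the receiving part may be a zero part (so a new part $1$ may be created), and parts that become $0$ are discarded. $\deg(\lambda)$ is the degree of $\lambda$ in $G_n$, $\Delta_n:=\max_{\lambda\vdash n}\deg(\lambda)$, $M_n:=\{\lambda\vdash n:\deg(\lambda)=\Delta_n\}$, $\Pi_n:=\{(A(\lambda),B(\lambda)):\lambda\in M_n\}$, $M_n^{(a,b)}:=\{\lambda\in M_n:(A(\lambda),B(\lambda))=(a,b)\}$, and $m_n^{\mathrm{sc}}:=|\{\lambda\in M_n:\lambda=\lambda'\}|$,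 where $\lambda'$ is the conjugate partition. *)

theory Defs
  imports "HOL-Library.Multiset"
begin

definition triangular :: "nat \<Rightarrow> nat" where
  "triangular m = m * (m + 1) div 2"

text \<open>A partition is the multiset of its (positive) parts.\<close>

definition partitions :: "nat \<Rightarrow> nat multiset set" where
  "partitions n = {\<nu>. 0 \<notin># \<nu> \<and> sum_mset \<nu> = n}"

text \<open>In the compressed form the distinct part sizes are listed in decreasing order; indices
  start at \<open>0\<close>, so \<open>part_sizes \<nu> ! i\<close> is $L_{i+1}$. The last gap is the smallest part itself.\<close>

definition part_sizes :: "nat multiset \<Rightarrow> nat list" where
  "part_sizes \<nu> = rev (sorted_list_of_set (set_mset \<nu>))"

definition gap :: "nat multiset \<Rightarrow> nat \<Rightarrow> nat" where
  "gap \<nu> i =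
     (if Suc i < length (part_sizes \<nu>)
      then part_sizes \<nu> ! i - part_sizes \<nu> ! Suc i
      else part_sizes \<nu> ! i)"

definition A_stat :: "nat multiset \<Rightarrow> nat" where
  "A_stat \<nu> = card {i. i < length (part_sizes \<nu>) \<and> gap \<nu> i > 1}"

definition B_stat :: "nat multiset \<Rightarrow> nat" where
  "B_stat \<nu> = card {i. i < length (part_sizes \<nu>) \<and> count \<nu> (part_sizes \<nu> ! i) > 1}"

text \<open>One unit moves from an occurrence of \<open>x\<close> to a different occurrence of \<open>y\<close>. A zero part is
  adjoined to \<open>\<nu>\<close> first, so that \<open>y = 0\<close> (creation of a new part \<open>1\<close>) is allowed; all zero parts
  are discarded at the end.\<close>

definition transfer :: "nat multiset \<Rightarrow> nat multiset \<Rightarrow> bool" where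
  "transfer \<nu> \<mu> \<longleftrightarrow>
     (\<exists>x y. x > 0 \<and> {#x, y#} \<subseteq># add_mset 0 \<nu> \<and>
            \<mu> = filter_mset (\<lambda>z. z > 0) (add_mset 0 \<nu> - {#x, y#} + {#x - 1, y + 1#}))"

definition adjacent :: "nat \<Rightarrow> nat multiset \<Rightarrow> nat multiset \<Rightarrow> bool" where
  "adjacent n \<nu> \<mu> \<longleftrightarrow>
     \<nu> \<in> partitions n \<and> \<mu> \<in> partitions n \<and> \<nu> \<noteq> \<mu> \<and> (transfer \<nu> \<mu> \<or> transfer \<mu> \<nu>)"

definition deg :: "nat \<Rightarrow> nat multiset \<Rightarrow> nat" where
  "deg n \<nu> = card {\<mu>. adjacent n \<nu> \<mu>}"

definition max_deg :: "nat \<Rightarrow> nat" where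
  "max_deg n = Max (deg n ` partitions n)"

definition max_deg_partitions :: "nat \<Rightarrow> nat multiset set" where
  "max_deg_partitions n = {\<nu> \<in> partitions n. deg n \<nu> = max_deg n}"

definition AB_pairs :: "nat \<Rightarrow> (nat \<times> nat) set" where
  "AB_pairs n = (\<lambda>\<nu>. (A_stat \<nu>, B_stat \<nu>)) ` max_deg_partitions n"

definition max_deg_partitions_AB :: "nat \<Rightarrow> nat \<times> nat \<Rightarrow> nat multiset set" where
  "max_deg_partitions_AB n ab = {\<nu> \<in> max_deg_partitions n. (A_stat \<nu>, B_stat \<nu>) = ab}"

text \<open>The columns of the Young diagram are indexed by the \<open>j\<close> with $1 \le j \le$ largest part;
  column \<open>j\<close> has as many cells as there are parts of size at least \<open>j\<close>.\<close>

definition conjugate :: "nat multiset \<Rightarrow> nat multiset" where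
  "conjugate \<nu> =
     image_mset (\<lambda>j. size {#x \<in># \<nu>. j \<le> x#}) (mset_set (\<Union>x\<in>set_mset \<nu>. {1..x}))"

definition num_self_conjugate :: "nat \<Rightarrow> nat" where
  "num_self_conjugate n = card {\<nu> \<in> max_deg_partitions n. conjugate \<nu> = \<nu>}"

end

theory Submission
  imports Defs
begin

text \<open>A partition with \<open>r\<close> distinct part sizes has degree \<open>r * (r - 1) + A + B\<close>, and \<open>A, B \<le> r\<close>, so a
  partition of \<open>T_s + 7\<close> of maximal degree has the largest possible number \<open>s\<close> of distinct sizes. Such a
  partition is the staircase \<open>(s, ..., 1)\<close> with \<open>A\<close> kinds of columns and \<open>B\<close> kinds of rows
  added, of total size \<open>7\<close>, whence \<open>T_A + T_B \<le> 7\<close>. This forces \<open>A + B \<le> 4\<close>, with equality for six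
  partitions.\<close>

section \<open>The degree of a partition\<close>

abbreviation positive_part :: "nat multiset \<Rightarrow> nat multiset" where
  "positive_part M \<equiv> filter_mset (\<lambda>z. z > 0) M"

lemma positive_part_id: "0 \<notin># M \<Longrightarrow> positive_part M = M"
  by (induction M) auto

lemma sum_positive_part: "sum_mset (positive_part M) = sum_mset M"
  by (induction M) auto

text \<open>Multiset subtraction and the removal of zeros give way to an equation between sums,
  which can be cancelled and counted; the adjoined zero drops out.\<close>

lemma transfer_result_eq:
  assumes "0 \<notin># \<nu>" and "{#x, y#} \<subseteq># add_mset 0 \<nu>"
  shows "\<mu> = positive_part (add_mset 0 \<nu> - {#x, y#} + {#x - 1, y + 1#}) \<longleftrightarrow>
    \<mu> + positive_part {#x, y#} = \<nu> + positive_part {#x - 1, y + 1#}"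
proof -
  define a where "a = positive_part (add_mset 0 \<nu> - {#x, y#})"
  have "a + positive_part {#x, y#} = positive_part (add_mset 0 \<nu>)"
    by (simp only: a_def filter_union_mset[symmetric] subset_mset.diff_add[OF assms(2)])
  then have "a + positive_part {#x, y#} = \<nu>"
    using assms(1) by (simp add: positive_part_id)
  then have "\<nu> + positive_part {#x - 1, y + 1#} =
      a + positive_part {#x - 1, y + 1#} + positive_part {#x, y#}"
    by (metis union_assoc union_commute)
  then show ?thesis by (simp only: filter_union_mset add_right_cancel flip: a_def)
qed

text \<open>The unit is sent back, from \<open>y + 1\<close> to \<open>x - 1\<close>; if
  \<open>x = 1\<close>, the receiver is the adjoined zero. Hence the symmetrised adjacency has no
  neighbours beyond the outgoing transfers.\<close>

lemma transfer_sym: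
  assumes "0 \<notin># \<nu>" "0 \<notin># \<mu>" "transfer \<nu> \<mu>"
  shows "transfer \<mu> \<nu>"
proof -
  obtain x y where x: "x > 0" and sub: "{#x, y#} \<subseteq># add_mset 0 \<nu>"
    and m: "\<mu> = positive_part (add_mset 0 \<nu> - {#x, y#} + {#x - 1, y + 1#})"
    using assms(3) unfolding transfer_def by blast
  have "positive_part {#x - 1, y + 1#} \<subseteq># \<mu>"
    unfolding m by (metis filter_union_mset mset_subset_eq_add_right)
  then have "add_mset 0 (positive_part {#x - 1, y + 1#}) \<subseteq># add_mset 0 \<mu>"
    by (simp only: mset_subset_eq_add_mset_cancel)
  moreover have "{#y + 1, x - 1#} \<subseteq># add_mset 0 (positive_part {#x - 1, y + 1#})"
    by (cases "x - 1 = 0") (auto simp: add_mset_commute)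
  ultimately have sub': "{#y + 1, x - 1#} \<subseteq># add_mset 0 \<mu>"
    by (meson subset_mset.order_trans)
  have "\<nu> + positive_part {#y + 1, x - 1#} = \<mu> + positive_part {#y + 1 - 1, x - 1 + 1#}"
    using m transfer_result_eq[OF assms(1) sub, of \<mu>] x
    by (simp add: add_mset_commute split: if_splits)
  then have "\<nu> = positive_part (add_mset 0 \<mu> - {#y + 1, x - 1#} + {#y + 1 - 1, x - 1 + 1#})"
    using transfer_result_eq[OF assms(2) sub'] by blast
  then show ?thesis
    unfolding transfer_def using sub' by (metis add_gr_0 zero_less_one)
qed

text \<open>For \<open>k > 0\<close> the number of parts of size at least \<open>k\<close> falls
  only at \<open>k = x\<close> and rises only at \<open>k = y + 1\<close>; as these differ, the
  changes reveal both \<open>x\<close> and \<open>y\<close>.\<close>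

lemma transfer_pair_unique:
  assumes "0 < x" "0 < x'" "x \<noteq> y + 1" "x' \<noteq> y' + 1"
    and "\<mu> + positive_part {#x, y#} = \<nu> + positive_part {#x - 1, y + 1#}"
    and "\<mu> + positive_part {#x', y'#} = \<nu> + positive_part {#x' - 1, y' + 1#}"
  shows "x = x' \<and> y = y'"
proof -
  define c where "c k M = size {#z \<in># M. k \<le> z#}" for k :: nat and M
  have c_add: "c k (M + N) = c k M + c k N" for k M N by (simp add: c_def)
  have c_pos: "c k (positive_part M) = c k M" if "k > 0" for k M
  proof -
    have "{#z \<in># positive_part M. k \<le> z#} = {#z \<in># M. k \<le> z#}"
      using that by (auto simp: filter_filter_mset intro: filter_mset_cong)
    then show ?thesis by (simp add: c_def)
  qed
  have eq: "c k {#x - 1, y + 1#} + c k {#x', y'#} = c k {#x' - 1, y' + 1#} + c k {#x, y#}"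
    if "k > 0" for k
  proof -
    have "c k \<mu> + c k {#x, y#} = c k \<nu> + c k {#x - 1, y + 1#}"
      using arg_cong[OF assms(5), of "c k"] that by (simp only: c_add c_pos)
    moreover have "c k \<mu> + c k {#x', y'#} = c k \<nu> + c k {#x' - 1, y' + 1#}"
      using arg_cong[OF assms(6), of "c k"] that by (simp only: c_add c_pos)
    ultimately show ?thesis by linarith
  qed
  have "x = x'" using eq[of x] assms(1-4) by (auto simp: c_def split: if_splits)
  moreover have "y = y'" using eq[of "y + 1"] assms(1-4) by (auto simp: c_def split: if_splits)
  ultimately show ?thesis by simp
qed

text \<open>Codes for the neighbours: \<open>y = 0\<close> is always allowed as the adjoined zero,
  and \<open>x = y + 1\<close> is barred because such a transfer merely swaps the two parts.\<close>

definition transfer_pairs :: "nat multiset \<Rightarrow> (nat \<times> nat) set" where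
  "transfer_pairs \<nu> = {(x, y). x \<in># \<nu> \<and> (y = 0 \<or> y \<in># \<nu>) \<and> x \<noteq> y + 1 \<and>
     (x = y \<longrightarrow> count \<nu> x > 1)}"

lemma pair_subseteq_iff:
  fixes \<nu> :: "nat multiset"
  assumes "0 \<notin># \<nu>" "x > 0"
  shows "{#x, y#} \<subseteq># add_mset 0 \<nu> \<longleftrightarrow>
    x \<in># \<nu> \<and> (y = 0 \<or> y \<in># \<nu>) \<and> (x = y \<longrightarrow> count \<nu> x > 1)"
proof (cases "x = y")
  case True
  have "{#x, y#} \<subseteq># M \<longleftrightarrow> count M x > 1" for M
    using True by (auto simp: subseteq_mset_def)
  moreover have "count (add_mset 0 \<nu>) x = count \<nu> x"
    using assms(2) by simp
  ultimately have "{#x, y#} \<subseteq># add_mset 0 \<nu> \<longleftrightarrow> count \<nu> x > 1"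
    by metis
  moreover have "x \<in># \<nu>" if "count \<nu> x > 1"
    using that by (metis count_greater_zero_iff less_trans zero_less_one)
  ultimately show ?thesis using True by blast
next
  case False
  then show ?thesis using assms
    by (auto simp: insert_subset_eq_iff in_diff_count)
qed

text \<open>Symmetry leaves only outgoing transfers, and uniqueness of the pair makes the map from
  pairs to neighbours injective.\<close>

lemma deg_eq_card_transfer_pairs:
  assumes "\<nu> \<in> partitions n"
  shows "deg n \<nu> = card (transfer_pairs \<nu>)"
proof -
  have nz: "0 \<notin># \<nu>" and sn: "sum_mset \<nu> = n" using assms by (auto simp: partitions_def)
  define f where "f = (\<lambda>(x, y). positive_part (add_mset 0 \<nu> - {#x, y#} + {#x - 1, y + 1#}))"
  have pairs: "x > 0 \<and> x \<noteq> y + 1 \<and> {#x, y#} \<subseteq># add_mset 0 \<nu>" if "(x, y) \<in> transfer_pairs \<nu>" for x y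
    using that nz pair_subseteq_iff[OF nz, of x y] unfolding transfer_pairs_def
    by (auto intro: gr0I)
  have f_eq: "f (x, y) + positive_part {#x, y#} = \<nu> + positive_part {#x - 1, y + 1#}"
    if "{#x, y#} \<subseteq># add_mset 0 \<nu>" for x y
    using transfer_result_eq[OF nz that] unfolding f_def prod.case by blast
  have inj: "inj_on f (transfer_pairs \<nu>)"
  proof (rule inj_onI, clarify)
    fix x y x' y' assume *: "(x, y) \<in> transfer_pairs \<nu>" "(x', y') \<in> transfer_pairs \<nu>"
      "f (x, y) = f (x', y')"
    show "x = x' \<and> y = y'"
      using transfer_pair_unique[of x x' y y' "f (x, y)" \<nu>] pairs[OF *(1)] pairs[OF *(2)] f_eq *(3)
      by metis
  qed
  have "{\<mu>. adjacent n \<nu> \<mu>} = f ` transfer_pairs \<nu>"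
  proof (intro set_eqI iffI)
    fix \<mu> assume "\<mu> \<in> {\<mu>. adjacent n \<nu> \<mu>}"
    then have "\<nu> \<noteq> \<mu>" "transfer \<nu> \<mu>"
      using transfer_sym by (auto simp: adjacent_def partitions_def)
    then obtain x y where xy: "x > 0" "{#x, y#} \<subseteq># add_mset 0 \<nu>" "\<mu> = f (x, y)"
      unfolding transfer_def f_def by auto
    have "x \<noteq> y + 1"
    proof
      assume "x = y + 1"
      then have "{#x - 1, y + 1#} = {#x, y#}" by simp
      then have "f (x, y) = \<nu>" using f_eq[OF xy(2)] by (simp only: add_right_cancel)
      then show False using xy(3) \<open>\<nu> \<noteq> \<mu>\<close> by simp
    qed
    then have "(x, y) \<in> transfer_pairs \<nu>"
      using pair_subseteq_iff[OF nz xy(1)] xy(2) by (auto simp: transfer_pairs_def)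
    then show "\<mu> \<in> f ` transfer_pairs \<nu>" using xy(3) by blast
  next
    fix \<mu> assume "\<mu> \<in> f ` transfer_pairs \<nu>"
    then obtain x y where xy: "(x, y) \<in> transfer_pairs \<nu>" "\<mu> = f (x, y)" by auto
    note p = pairs[OF xy(1)]
    have \<mu>: "\<mu> = positive_part (add_mset 0 \<nu> - {#x, y#} + {#x - 1, y + 1#})"
      using xy(2) by (simp only: f_def prod.case)
    then have "transfer \<nu> \<mu>" unfolding transfer_def using p by blast
    have "\<mu> \<noteq> \<nu>"
    proof
      assume "\<mu> = \<nu>"
      then have "positive_part {#x, y#} = positive_part {#x - 1, y + 1#}"
        using f_eq p xy(2) by (metis add_left_cancel)
      moreover have "x \<in># positive_part {#x, y#}" using p by simp
      ultimately have "x \<in># positive_part {#x - 1, y + 1#}" by (simp only:)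
      then show False using p by (auto split: if_splits)
    qed
    have "sum_mset \<mu> + (x + y) = sum_mset \<nu> + (x - 1 + (y + 1))"
      using arg_cong[OF f_eq[of x y], of sum_mset] p xy(2)
      by (simp only: sum_mset.union sum_positive_part) simp
    then have "sum_mset \<mu> = n" using p sn by linarith
    have "0 \<notin># \<mu>" unfolding \<mu> set_mset_filter by blast
    then have "\<mu> \<in> partitions n"
      using \<open>sum_mset \<mu> = n\<close> by (simp add: partitions_def)
    then show "\<mu> \<in> {\<mu>. adjacent n \<nu> \<mu>}"
      using assms \<open>transfer \<nu> \<mu>\<close> \<open>\<mu> \<noteq> \<nu>\<close> unfolding adjacent_def by blast
  qed
  then show ?thesis using inj by (simp add: deg_def card_image)
qed

section \<open>The statistics \<open>A\<close> and \<open>B\<close> in terms of the underlying set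
  of parts\<close>

lemma part_sizes_bij: "bij_betw (\<lambda>i. part_sizes \<nu> ! i) {i. i < length (part_sizes \<nu>)} (set_mset \<nu>)"
proof -
  have "distinct (part_sizes \<nu>)" "set (part_sizes \<nu>) = set_mset \<nu>"
    by (auto simp: part_sizes_def)
  then show ?thesis using bij_betw_nth[of "part_sizes \<nu>"] by (auto simp: lessThan_def)
qed

lemma part_sizes_less:
  assumes "i < j" "j < length (part_sizes \<nu>)"
  shows "part_sizes \<nu> ! j < part_sizes \<nu> ! i"
proof -
  have "sorted_wrt (<) (sorted_list_of_set (set_mset \<nu>))" by simp
  then have "sorted_wrt (\<lambda>x y. y < x) (part_sizes \<nu>)"
    by (simp only: part_sizes_def sorted_wrt_rev)
  then show ?thesis using assms sorted_wrt_nth_less by blast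
qed

lemma card_part_sizes_index:
  "card {i. i < length (part_sizes \<nu>) \<and> P (part_sizes \<nu> ! i)} = card {x \<in> set_mset \<nu>. P x}"
proof -
  have "bij_betw (\<lambda>i. part_sizes \<nu> ! i) {i. i < length (part_sizes \<nu>) \<and> P (part_sizes \<nu> ! i)}
      {x \<in> set_mset \<nu>. P x}"
    using part_sizes_bij[of \<nu>] unfolding bij_betw_def inj_on_def by auto
  then show ?thesis by (rule bij_betw_same_card)
qed

text \<open>Sizes decrease strictly, so one less than a size can only be the next in the list. The
  condition \<open>> 1\<close> handles a part 1, which has gap 1 although 0 never occurs.\<close>

lemma gap_gt_1_iff:
  assumes "0 \<notin># \<nu>" "i < length (part_sizes \<nu>)"
  shows "gap \<nu> i > 1 \<longleftrightarrow> part_sizes \<nu> ! i > 1 \<and> part_sizes \<nu> ! i - 1 \<notin># \<nu>"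
proof -
  let ?p = "part_sizes \<nu>"
  have set: "set ?p = set_mset \<nu>" by (simp add: part_sizes_def)
  have mem: "y \<in># \<nu> \<longleftrightarrow> (\<exists>j < length ?p. ?p ! j = y)" for y
    using set by (metis in_set_conv_nth)
  have later: "Suc i \<le> j" if "?p ! j < ?p ! i" "j < length ?p" for j
    using that part_sizes_less[of j i \<nu>] assms(2) by (metis less_asym' nat_neq_iff Suc_leI)
  show ?thesis
  proof (cases "Suc i < length ?p")
    case True
    have pos: "?p ! Suc i > 0" using True mem assms(1) by (metis gr0I)
    have lt: "?p ! Suc i < ?p ! i" using part_sizes_less True by blast
    have g: "gap \<nu> i = ?p ! i - ?p ! Suc i" using True by (simp add: gap_def)
    have "?p ! i - 1 \<in># \<nu> \<longleftrightarrow> ?p ! i - 1 = ?p ! Suc i"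
    proof
      assume "?p ! i - 1 \<in># \<nu>"
      then obtain j where j: "j < length ?p" "?p ! j = ?p ! i - 1" using mem by blast
      then have "Suc i \<le> j" using later lt by simp
      then have "?p ! j \<le> ?p ! Suc i"
        using part_sizes_less[of "Suc i" j \<nu>] j(1) by (cases "j = Suc i") auto
      then show "?p ! i - 1 = ?p ! Suc i" using j lt by linarith
    qed (use mem True in auto)
    then show ?thesis using g pos lt by auto
  next
    case False
    have "?p ! i - 1 \<notin># \<nu>" if "?p ! i > 1"
    proof
      assume "?p ! i - 1 \<in># \<nu>"
      then obtain j where j: "j < length ?p" "?p ! j = ?p ! i - 1" using mem by blast
      then have "Suc i \<le> j" using later that by simp
      then show False using j False by simp
    qed
    then show ?thesis using False by (auto simp: gap_def)
  qed
qed

lemma A_stat_eq: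
  assumes "0 \<notin># \<nu>"
  shows "A_stat \<nu> = card {x \<in> set_mset \<nu>. x > 1 \<and> x - 1 \<notin># \<nu>}"
proof -
  have "{i. i < length (part_sizes \<nu>) \<and> gap \<nu> i > 1} =
    {i. i < length (part_sizes \<nu>) \<and> (part_sizes \<nu> ! i > 1 \<and> part_sizes \<nu> ! i - 1 \<notin># \<nu>)}"
    using gap_gt_1_iff[OF assms] by blast
  then show ?thesis
    unfolding A_stat_def using card_part_sizes_index[of \<nu> "\<lambda>x. x > 1 \<and> x - 1 \<notin># \<nu>"] by simp
qed

lemma B_stat_eq: "B_stat \<nu> = card {x \<in> set_mset \<nu>. count \<nu> x > 1}"
  unfolding B_stat_def by (rule card_part_sizes_index)

text \<open>Of the \<open>r * (r + 1)\<close> source-target pairs, those with \<open>x = y + 1\<close> change nothing and those with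
  \<open>x = y\<close> need a repeated part.\<close>

lemma deg_formula:
  assumes "\<nu> \<in> partitions n"
  defines "r \<equiv> card (set_mset \<nu>)"
  shows "deg n \<nu> + r = r * r + A_stat \<nu> + B_stat \<nu>"
proof -
  let ?S = "set_mset \<nu>"
  have nz: "0 \<notin># \<nu>" using assms by (simp add: partitions_def)
  let ?P = "?S \<times> insert 0 ?S"
  let ?A = "{x \<in> ?S. x > 1 \<and> x - 1 \<notin># \<nu>}"
  let ?B = "{x \<in> ?S. count \<nu> x > 1}"
  \<comment> \<open>For \<open>x\<close> outside \<open>?A\<close> the target \<open>x - 1\<close>
    is available, either as a part or, when \<open>x = 1\<close>, as the adjoined zero.\<close>
  let ?X = "(\<lambda>x. (x, x - 1)) ` (?S - ?A)"
  let ?Y = "(\<lambda>x. (x, x)) ` (?S - ?B)"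
  have pos: "x > 0" if "x \<in># \<nu>" for x using that nz by (metis gr0I)
  have P: "?P = transfer_pairs \<nu> \<union> (?X \<union> ?Y)"
    using nz pos by (force simp: transfer_pairs_def image_iff)
  have d1: "transfer_pairs \<nu> \<inter> (?X \<union> ?Y) = {}" and d2: "?X \<inter> ?Y = {}"
    using pos by (fastforce simp: transfer_pairs_def)+
  have fin: "finite (transfer_pairs \<nu>)"
    by (rule finite_subset[of _ ?P]) (use P in blast, simp)
  have "card ?P = card (transfer_pairs \<nu>) + (card ?X + card ?Y)"
    unfolding P using d1 d2 fin by (simp add: card_Un_disjoint)
  moreover have "card ?P = r * (r + 1)"
    using nz by (simp add: card_cartesian_product r_def)
  moreover have "card ?X = r - A_stat \<nu>"
    unfolding A_stat_eq[OF nz] r_def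
    by (subst card_image) (auto simp: inj_on_def intro!: card_Diff_subset)
  moreover have "card ?Y = r - B_stat \<nu>"
    unfolding B_stat_eq r_def
    by (subst card_image) (auto simp: inj_on_def intro!: card_Diff_subset)
  moreover have "A_stat \<nu> \<le> r" "B_stat \<nu> \<le> r"
    unfolding A_stat_eq[OF nz] B_stat_eq r_def by (auto intro!: card_mono)
  moreover have "deg n \<nu> = card (transfer_pairs \<nu>)" by (rule deg_eq_card_transfer_pairs) fact
  ultimately show ?thesis by simp
qed

section \<open>Staircases\<close>

text \<open>A set of \<open>s\<close> positive integers is the staircase \<open>s, ..., 1\<close> whose top \<open>f\<close> steps are raised
  by one for each \<open>f\<close> in a multiset \<open>F\<close>; \<open>row s F i\<close> is its \<open>i\<close>-th largest element. In terms of the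
  compressed form, the gap below row \<open>i\<close> is \<open>1 + count F i\<close>.\<close>

definition row :: "nat \<Rightarrow> nat multiset \<Rightarrow> nat \<Rightarrow> nat" where
  "row s F i = s + 1 - i + size {#f \<in># F. i \<le> f#}"

definition staircase :: "nat \<Rightarrow> nat multiset \<Rightarrow> nat set" where
  "staircase s F = row s F ` {1..s}"

lemma row_less:
  assumes "i < j" "j \<le> s + 1"
  shows "row s F j < row s F i"
proof -
  have "{#f \<in># F. j \<le> f#} \<subseteq># {#f \<in># F. i \<le> f#}"
    using assms by (auto simp: subseteq_mset_def)
  then show ?thesis
    using size_mset_mono assms by (fastforce simp: row_def)
qed

lemma inj_on_row: "inj_on (row s F) {1..s}"
  by (rule inj_onI) (metis atLeastAtMost_iff le_SucI Suc_eq_plus1 less_irrefl linorder_neqE_nat row_less)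

lemma card_staircase: "card (staircase s F) = s"
  unfolding staircase_def card_image[OF inj_on_row] by simp

lemma finite_staircase [simp]: "finite (staircase s F)"
  by (simp add: staircase_def)

lemma zero_notin_staircase: "0 \<notin> staircase s F"
  by (auto simp: staircase_def row_def)

text \<open>Interchange of summation: a column of height \<open>f\<close> meets the rows
  \<open>1, ..., f\<close>, all present since \<open>f \<le> s\<close>, and so adds exactly
  \<open>f\<close>.\<close>

lemma sum_staircase:
  assumes "set_mset F \<subseteq> {1..s}"
  shows "\<Sum>(staircase s F) = triangular s + sum_mset F"
proof -
  have "(\<Sum>i\<in>{1..s}. s + 1 - i) = (\<Sum>i\<in>{1..s}. i)"
    using sum.atLeastAtMost_rev[of "\<lambda>i. i" 1 s] by simp
  also have "\<dots> = triangular s"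
    using gauss_sum_from_Suc_0[of s, where ?'a = nat] by (simp add: triangular_def)
  finally have base: "(\<Sum>i\<in>{1..s}. s + 1 - i) = triangular s" .
  have "(\<Sum>i\<in>{1..s}. size {#f \<in># F. i \<le> f#}) = sum_mset F"
    using assms
  proof (induction F)
    case empty
    show ?case by simp
  next
    case (add x F)
    have "(\<Sum>i\<in>{1..s}. size {#f \<in># add_mset x F. i \<le> f#}) =
        (\<Sum>i\<in>{1..s}. (if i \<le> x then 1 else 0) + size {#f \<in># F. i \<le> f#})"
      by (rule sum.cong) auto
    also have "\<dots> = card {i \<in> {1..s}. i \<le> x} + sum_mset F"
      using add by (simp add: sum.distrib flip: sum.inter_filter)
    also have "{i \<in> {1..s}. i \<le> x} = {1..x}" using add.prems by auto
    finally show ?case by simp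
  qed
  then show ?thesis
    using base unfolding staircase_def sum.reindex[OF inj_on_row]
    by (simp only: row_def o_def sum.distrib)
qed

text \<open>Consecutive rows differ by one plus the number of columns ending there, so wide gaps sit
  exactly at the values occurring in \<open>F\<close>; repetitions only widen them.\<close>

lemma card_staircase_gaps:
  assumes "set_mset F \<subseteq> {1..s}"
  shows "card {x \<in> staircase s F. x > 1 \<and> x - 1 \<notin> staircase s F} = card (set_mset F)"
proof -
  have step: "row s F i = row s F (i + 1) + 1 + count F i" if "i \<in> {1..s}" for i
  proof -
    have "{#f \<in># F. i \<le> f#} = {#f \<in># F. i + 1 \<le> f#} + replicate_mset (count F i) i"
      by (rule multiset_eqI) auto
    then show ?thesis using that by (auto simp: row_def)
  qed
  \<comment> \<open>A fictitious row \<open>s + 1\<close> of length 0 turns the last gap, the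
    smallest part itself, into a difference like the others.\<close>
  have last: "row s F (s + 1) = 0"
    using assms by (force simp: row_def)
  have "row s F i > 1 \<and> row s F i - 1 \<notin> staircase s F \<longleftrightarrow> i \<in># F" if i: "i \<in> {1..s}" for i
  proof (cases "i \<in># F")
    case True
    then have "count F i > 0" by simp
    then have big: "row s F i - 1 > row s F (i + 1)" using step[OF i] by linarith
    have "row s F i - 1 \<noteq> row s F j" if "j \<in> {1..s}" for j
    proof (cases i j rule: linorder_cases)
      case less
      then have "row s F j \<le> row s F (i + 1)"
        using row_less[of "i + 1" j s F] that by (cases "j = i + 1") auto
      then show ?thesis using big by simp
    next
      case equal
      then show ?thesis using big by simp
    next
      case greater
      then show ?thesis using row_less[of j i s F] i by simp
    qed
    then have "row s F i - 1 \<notin> staircase s F" unfolding staircase_def by blast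
    then show ?thesis using True big by simp
  next
    case False
    then have "count F i = 0" by (simp add: not_in_iff)
    then have "row s F i - 1 = row s F (i + 1)" "row s F i = 1 + row s F (i + 1)"
      using step[OF i] by simp_all
    then show ?thesis using i False last by (cases "i = s") (auto simp: staircase_def)
  qed
  then have "{i \<in> {1..s}. row s F i > 1 \<and> row s F i - 1 \<notin> staircase s F} = set_mset F"
    using assms by blast
  moreover have "{x \<in> staircase s F. x > 1 \<and> x - 1 \<notin> staircase s F} =
      row s F ` {i \<in> {1..s}. row s F i > 1 \<and> row s F i - 1 \<notin> staircase s F}"
    unfolding staircase_def by blast
  moreover have "inj_on (row s F) (set_mset F)"
    using inj_on_row assms inj_on_subset by blast
  ultimately show ?thesis by (simp add: card_image)
qed

text \<open>The multiset \<open>F\<close> records, for each positive \<open>h\<close> missing from \<open>S\<close> below its maximum, the number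
  of elements of \<open>S\<close> above \<open>h\<close>.\<close>

lemma staircase_exhaust:
  assumes "finite S" "0 \<notin> S"
  obtains F where "set_mset F \<subseteq> {1..card S}" "S = staircase (card S) F"
proof
  let ?s = "card S"
  define H where "H = {h. 0 < h \<and> h \<notin> S \<and> (\<exists>x\<in>S. h < x)}"
  define a where "a h = card {y \<in> S. h < y}" for h
  define F where "F = image_mset a (mset_set H)"
  have "H \<subseteq> (\<Union>x\<in>S. {..<x})" by (auto simp: H_def)
  then have finH: "finite H" using assms(1) finite_subset by fastforce
  have "a h \<in> {1..?s}" if "h \<in> H" for h
  proof -
    have "{y \<in> S. h < y} \<noteq> {}" using that by (auto simp: H_def)
    then have "a h > 0" unfolding a_def using assms(1) by (simp add: card_gt_0_iff)
    moreover have "a h \<le> ?s" unfolding a_def using assms(1) by (intro card_mono) auto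
    ultimately show ?thesis by simp
  qed
  then show "set_mset F \<subseteq> {1..?s}" using finH by (auto simp: F_def)
  have "x \<in> staircase ?s F" if x: "x \<in> S" for x
  proof -
    \<comment> \<open>The rank of \<open>x\<close> in \<open>S\<close>, counted from the top: the
      index of the row that should equal \<open>x\<close>.\<close>
    define i where "i = card {y \<in> S. x \<le> y}"
    have xpos: "x > 0" using x assms(2) by (metis gr0I)
    have "{y \<in> S. x \<le> y} \<noteq> {}" using x by auto
    then have i1: "i \<ge> 1" unfolding i_def using assms(1) by (simp add: card_gt_0_iff Suc_le_eq)
    have i2: "i \<le> ?s" unfolding i_def using assms(1) by (intro card_mono) auto
    \<comment> \<open>This identifies the columns reaching row \<open>i\<close> with the missing
      values below \<open>x\<close>.\<close>
    have "i \<le> a h \<longleftrightarrow> h < x" if h: "h \<in> H" for h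
    proof
      assume "h < x"
      then show "i \<le> a h" unfolding i_def a_def using assms(1) by (intro card_mono) auto
    next
      assume *: "i \<le> a h"
      show "h < x"
      proof (rule ccontr)
        assume "\<not> h < x"
        then have "{y \<in> S. h < y} \<subset> {y \<in> S. x \<le> y}" using x by auto
        then have "a h < i" unfolding a_def i_def using assms(1) by (intro psubset_card_mono) auto
        then show False using * by simp
      qed
    qed
    then have "{h \<in> H. i \<le> a h} = {h \<in> H. h < x}" by blast
    moreover have "h \<in> H \<and> h < x \<longleftrightarrow> h \<in> {1..x} \<and> h \<notin> S" for h
      using x by (cases "h = x") (auto simp: H_def intro!: bexI[of _ x])
    ultimately have "{h \<in> H. i \<le> a h} = {h \<in> {1..x}. h \<notin> S}" by blast
    then have holes: "size {#f \<in># F. i \<le> f#} = card {h \<in> {1..x}. h \<notin> S}"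
      using finH by (simp add: F_def filter_mset_image_mset filter_mset_mset_set)
    have "?s = card ({y \<in> S. y < x} \<union> {y \<in> S. x \<le> y})"
      by (rule arg_cong[of _ _ card]) auto
    also have "\<dots> = card {y \<in> S. y < x} + i"
      unfolding i_def using assms(1) by (intro card_Un_disjoint) auto
    finally have s: "?s = card {y \<in> S. y < x} + i" .
    have "{y \<in> S. y \<le> x} = insert x {y \<in> S. y < x}" using x by auto
    then have le: "card {y \<in> S. y \<le> x} = card {y \<in> S. y < x} + 1" using assms(1) by simp
    have "x = card {1..x}" by simp
    also have "{1..x} = {y \<in> S. y \<le> x} \<union> {h \<in> {1..x}. h \<notin> S}"
      using assms(2) by (auto simp: Suc_le_eq intro: gr0I)
    also have "card \<dots> = card {y \<in> S. y \<le> x} + card {h \<in> {1..x}. h \<notin> S}"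
      using assms(1) by (intro card_Un_disjoint) auto
    finally have "x = row ?s F i"
      unfolding row_def holes using s le by linarith
    then show ?thesis using i1 i2 by (auto simp: staircase_def)
  qed
  \<comment> \<open>One inclusion suffices: both sets have \<open>card S\<close> elements.\<close>
  then show "S = staircase ?s F"
    by (intro card_subset_eq) (auto simp: card_staircase)
qed

text \<open>\<open>F\<close> lists the heights of added columns and \<open>E\<close> the lengths of
  added rows. With \<open>E\<close> drawn from sizes already present, the set of parts stays the
  staircase.\<close>

definition staircase_partition :: "nat \<Rightarrow> nat multiset \<Rightarrow> nat multiset \<Rightarrow> nat multiset" where
  "staircase_partition s F E = mset_set (staircase s F) + E"

lemma sum_mset_mset_set: "sum_mset (mset_set A) = \<Sum>A" for A :: "nat set"
  by (simp add: sum_unfold_sum_mset)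

text \<open>The two statistics decouple: columns alone control the gaps, and rows alone the
  multiplicities. Repeated entries add cells but no degree.\<close>

lemma staircase_partition_stats:
  assumes "set_mset F \<subseteq> {1..s}" "set_mset E \<subseteq> staircase s F"
  defines "\<nu> \<equiv> staircase_partition s F E"
  shows "set_mset \<nu> = staircase s F"
    and "\<nu> \<in> partitions (triangular s + sum_mset F + sum_mset E)"
    and "A_stat \<nu> = card (set_mset F)"
    and "B_stat \<nu> = card (set_mset E)"
    and "deg (triangular s + sum_mset F + sum_mset E) \<nu> + s =
      s * s + card (set_mset F) + card (set_mset E)"
proof -
  show set: "set_mset \<nu> = staircase s F"
    using assms by (auto simp: staircase_partition_def)
  then have nz: "0 \<notin># \<nu>" by (simp add: zero_notin_staircase)
  then show part: "\<nu> \<in> partitions (triangular s + sum_mset F + sum_mset E)"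
    using sum_staircase[OF assms(1)]
    by (simp add: partitions_def \<nu>_def staircase_partition_def sum_mset_mset_set)
  show A: "A_stat \<nu> = card (set_mset F)"
    unfolding A_stat_eq[OF nz] set by (rule card_staircase_gaps) fact
  have "{x \<in> set_mset \<nu>. count \<nu> x > 1} = set_mset E"
    using assms(2) by (auto simp: set) (auto simp: \<nu>_def staircase_partition_def)
  then show B: "B_stat \<nu> = card (set_mset E)"
    unfolding B_stat_eq by simp
  show "deg (triangular s + sum_mset F + sum_mset E) \<nu> + s =
      s * s + card (set_mset F) + card (set_mset E)"
    using deg_formula[OF part] by (simp add: A B set card_staircase)
qed

lemma staircase_partition_exhaust:
  assumes "0 \<notin># \<nu>" "card (set_mset \<nu>) = s"
  obtains F E where "set_mset F \<subseteq> {1..s}" "set_mset E \<subseteq> staircase s F"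
    "\<nu> = staircase_partition s F E"
proof -
  obtain F where F: "set_mset F \<subseteq> {1..s}" "set_mset \<nu> = staircase s F"
    using staircase_exhaust[of "set_mset \<nu>"] assms by auto
  have sub: "mset_set (set_mset \<nu>) \<subseteq># \<nu>" by (rule mset_set_set_mset_msubset)
  have "\<nu> = staircase_partition s F (\<nu> - mset_set (set_mset \<nu>))"
    unfolding staircase_partition_def F(2)[symmetric] using sub by simp
  moreover have "set_mset (\<nu> - mset_set (set_mset \<nu>)) \<subseteq> staircase s F"
    unfolding F(2)[symmetric] by (auto dest: in_diffD)
  ultimately show ?thesis using that F(1) by blast
qed

text \<open>Whatever is added to the staircase only increases the sum. This serves for partitions as
  well as for \<open>F\<close> and \<open>E\<close> themselves.\<close>

lemma triangular_card_le_sum_mset: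
  assumes "0 \<notin># M"
  shows "triangular (card (set_mset M)) \<le> sum_mset M"
proof -
  obtain F E where FE: "set_mset F \<subseteq> {1..card (set_mset M)}"
      "set_mset E \<subseteq> staircase (card (set_mset M)) F"
      "M = staircase_partition (card (set_mset M)) F E"
    using staircase_partition_exhaust[OF assms refl] by blast
  from staircase_partition_stats(2)[OF FE(1,2)] FE(3) show ?thesis
    by (simp add: partitions_def)
qed

lemma triangular_Suc: "triangular (Suc m) = triangular m + Suc m"
  by (simp add: triangular_def)

lemma triangular_mono: "a \<le> b \<Longrightarrow> triangular a \<le> triangular b"
  unfolding triangular_def by (intro div_le_mono mult_le_mono) auto

section \<open>The extremal pairs\<close>

text \<open>Three distinct values against one cost \<open>6 + 1\<close>, all seven cells; two
  against two cost \<open>3 + 3\<close>, and the spare cell turns \<open>{#1, 2#}\<close> into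
  \<open>{#1, 3#}\<close> or \<open>{#1, 1, 2#}\<close> on either side.\<close>

definition extremal_pairs :: "(nat multiset \<times> nat multiset) set" where
  "extremal_pairs =
    {({#1, 2, 3#}, {#1#}), ({#1, 2#}, {#1, 3#}), ({#1, 2#}, {#1, 1, 2#}),
     ({#1, 3#}, {#1, 2#}), ({#1, 1, 2#}, {#1, 2#}), ({#1#}, {#1, 2, 3#})}"

section \<open>Multisets of small sum with a given number of distinct values\<close>

lemma sum_mset_eq_0D: "0 \<notin># M \<Longrightarrow> sum_mset M = 0 \<Longrightarrow> M = {#}" for M :: "nat multiset"
  by (cases M) auto

lemma sum_mset_eq_1D: "0 \<notin># M \<Longrightarrow> sum_mset M = 1 \<Longrightarrow> M = {#1#}" for M :: "nat multiset"
  by (cases M) (auto simp: add_is_1 dest: sum_mset_eq_0D)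

lemma split_support:
  fixes M :: "nat multiset"
  assumes "0 \<notin># M" "set_mset M = T"
  obtains R where "M = mset_set T + R" "set_mset R \<subseteq> T" "0 \<notin># R" "\<Sum>T + sum_mset R = sum_mset M"
proof
  have "mset_set T \<subseteq># M" using assms(2) mset_set_set_mset_msubset by blast
  then show "M = mset_set T + (M - mset_set T)" by simp
  then show "\<Sum>T + sum_mset (M - mset_set T) = sum_mset M"
    by (metis sum_mset.union sum_mset_mset_set)
  show "set_mset (M - mset_set T) \<subseteq> T" "0 \<notin># M - mset_set T"
    using assms by (auto dest: in_diffD)
qed

lemma two_distinct_parts:
  fixes M :: "nat multiset"
  assumes "0 \<notin># M" "card (set_mset M) = 2" "sum_mset M \<le> 4"
  shows "sum_mset M = 3 \<and> M = {#1, 2#} \<or> sum_mset M = 4 \<and> (M = {#1, 3#} \<or> M = {#1, 1, 2#})"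
proof -
  obtain a b where ab: "set_mset M = {a, b}" "a < b"
    using assms(2) by (metis card_2_iff insert_commute linorder_neqE_nat)
  obtain R where R: "M = mset_set {a, b} + R" "0 \<notin># R" "\<Sum>{a, b} + sum_mset R = sum_mset M"
    using split_support[OF assms(1) ab(1)] by blast
  have "a > 0" using assms(1) ab by (auto intro: gr0I)
  moreover have sum: "a + b + sum_mset R = sum_mset M" using R(3) ab(2) by simp
  ultimately have "a = 1 \<and> b = 2 \<and> sum_mset R = 0 \<or> a = 1 \<and> b = 3 \<and> sum_mset R = 0 \<or>
      a = 1 \<and> b = 2 \<and> sum_mset R = 1"
    using sum ab(2) assms(3) by presburger
  then show ?thesis
    using R sum_mset_eq_0D[OF R(2)] sum_mset_eq_1D[OF R(2)] by (auto simp: add_mset_commute)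
qed

text \<open>Three distinct positive values already sum to at least 6, so neither the values nor the
  multiplicities can grow.\<close>

lemma three_distinct_parts:
  fixes M :: "nat multiset"
  assumes "0 \<notin># M" "card (set_mset M) = 3" "sum_mset M \<le> 6"
  shows "M = {#1, 2, 3#}"
proof -
  obtain R where R: "M = mset_set (set_mset M) + R" "0 \<notin># R"
      "\<Sum>(set_mset M) + sum_mset R = sum_mset M"
    using split_support[OF assms(1) refl] by blast
  obtain F where F: "set_mset F \<subseteq> {1..3}" "set_mset M = staircase 3 F"
    using staircase_exhaust[of "set_mset M"] assms(1,2) by auto
  have "sum_mset F = 0" "sum_mset R = 0"
    using sum_staircase[OF F(1)] R(3) assms(3) unfolding F(2) triangular_def by presburger+
  moreover have "0 \<notin># F" using F(1) by auto
  ultimately have FR: "F = {#}" "R = {#}" using sum_mset_eq_0D R(2) by blast+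
  have "{1..3} = {1, 2, 3::nat}" by auto
  then have "set_mset M = {1, 2, 3}" using F(2) FR by (auto simp: staircase_def row_def)
  then show ?thesis using R(1) FR by simp
qed

text \<open>Four distinct values on one side would need 10 cells, and a total of five or more with
  at most three on each side would need at least \<open>6 + 3\<close>.\<close>

lemma extremal_pairs_exhaust:
  assumes "0 \<notin># F" "0 \<notin># E" "sum_mset F + sum_mset E = 7"
  shows "card (set_mset F) + card (set_mset E) \<le> 4"
    and "card (set_mset F) + card (set_mset E) = 4 \<Longrightarrow> (F, E) \<in> extremal_pairs"
proof -
  let ?a = "card (set_mset F)" and ?b = "card (set_mset E)"
  note tri_le = triangular_card_le_sum_mset[OF assms(1)] triangular_card_le_sum_mset[OF assms(2)]
  have tri_values: "triangular 0 = 0" "triangular 1 = 1" "triangular 2 = 3" "triangular 3 = 6"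
      "triangular 4 = 10" by (auto simp: triangular_def)
  have "?a < 4" using triangular_mono[of 4 ?a] tri_le assms(3) tri_values by linarith
  moreover have "?b < 4" using triangular_mono[of 4 ?b] tri_le assms(3) tri_values by linarith
  ultimately have ab: "?a = 0 \<or> ?a = 1 \<or> ?a = 2 \<or> ?a = 3" "?b = 0 \<or> ?b = 1 \<or> ?b = 2 \<or> ?b = 3"
    by presburger+
  show "?a + ?b \<le> 4"
    using ab tri_le assms(3) tri_values by (elim disjE) simp_all
  assume "?a + ?b = 4"
  then have "?a = 3 \<and> ?b = 1 \<or> ?a = 2 \<and> ?b = 2 \<or> ?a = 1 \<and> ?b = 3"
    using ab by presburger
  then consider "?a = 3" "?b = 1" | "?a = 2" "?b = 2" | "?a = 1" "?b = 3"
    by blast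
  then show "(F, E) \<in> extremal_pairs"
  proof cases
    case 1
    then have "sum_mset F = 6" "sum_mset E = 1" using tri_le assms(3) tri_values by auto
    then show ?thesis using three_distinct_parts[OF assms(1)] sum_mset_eq_1D[OF assms(2)] 1
      by (simp add: extremal_pairs_def)
  next
    case 2
    then have "sum_mset F \<le> 4" "sum_mset E \<le> 4" using tri_le assms(3) tri_values by auto
    then show ?thesis
      using two_distinct_parts[OF assms(1)] two_distinct_parts[OF assms(2)] 2 assms(3)
      by (auto simp: extremal_pairs_def)
  next
    case 3
    then have "sum_mset F = 1" "sum_mset E = 6" using tri_le assms(3) tri_values by auto
    then show ?thesis using three_distinct_parts[OF assms(2)] sum_mset_eq_1D[OF assms(1)] 3
      by (simp add: extremal_pairs_def)
  qed
qed

text \<open>Columns have height at most 3, so only the top three rows move and the rest remains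
  \<open>{1..s - 3}\<close>. For \<open>s \<ge> 7\<close> this contains the lengths in
  \<open>E\<close>, which are at most 3.\<close>

lemma extremal_pairs_props:
  assumes "(F, E) \<in> extremal_pairs" "s \<ge> 7"
  shows "set_mset F \<subseteq> {1..s}" "set_mset E \<subseteq> staircase s F" "0 \<notin># F"
    and "sum_mset F + sum_mset E = 7" "card (set_mset F) + card (set_mset E) = 4"
    and "{1..s - 3} \<subseteq> staircase s F"
    and "staircase s F \<subseteq> {1..s - 3} \<union> row s F ` {1, 2, 3}"
proof -
  have F3: "set_mset F \<subseteq> {1..3}" and E4: "set_mset E \<subseteq> {1..3}"
    using assms(1) by (auto simp: extremal_pairs_def)
  then show "set_mset F \<subseteq> {1..s}" using assms(2) by auto
  show "0 \<notin># F" using F3 by auto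
  show "sum_mset F + sum_mset E = 7" "card (set_mset F) + card (set_mset E) = 4"
    using assms(1) by (auto simp: extremal_pairs_def)
  have low: "row s F i = s + 1 - i" if "i > 3" for i
    using that F3 by (force simp: row_def)
  show sub: "{1..s - 3} \<subseteq> staircase s F"
  proof
    fix x assume "x \<in> {1..s - 3}"
    then have "x = row s F (s + 1 - x)" "s + 1 - x \<in> {1..s}" using low assms(2) by auto
    then show "x \<in> staircase s F" unfolding staircase_def by blast
  qed
  have "{1..3} \<subseteq> {1..s - 3}" using assms(2) by auto
  then show "set_mset E \<subseteq> staircase s F" using E4 sub by blast
  show "staircase s F \<subseteq> {1..s - 3} \<union> row s F ` {1, 2, 3}"
  proof
    fix x assume "x \<in> staircase s F"
    then obtain i where i: "i \<in> {1..s}" "x = row s F i" by (auto simp: staircase_def)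
    show "x \<in> {1..s - 3} \<union> row s F ` {1, 2, 3}"
    proof (cases "i > 3")
      case True
      then show ?thesis using low i by auto
    next
      case False
      then have "i \<in> {1, 2, 3}" using i(1) by auto
      then show ?thesis using i(2) by blast
    qed
  qed
qed

section \<open>The maximal degree and the partitions attaining it\<close>

text \<open>The next triangular number is \<open>s + 1 \<ge> 8\<close> further on, so
  \<open>s + 1\<close> distinct sizes do not fit; the bound 7 is sharp here.\<close>

lemma less_triangular_Suc:
  assumes "s \<ge> 7"
  shows "triangular s + 7 < triangular (Suc s)"
  using assms by (simp add: triangular_Suc)

text \<open>With \<open>r < s\<close> sizes, \<open>A, B \<le> r\<close> caps the degree at
  \<open>r * (r + 1) \<le> s * s - s\<close>, four below the value at the extremal pairs; with
  \<open>s\<close> sizes, the seven added cells decide.\<close>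

lemma max_degree_classification:
  assumes "s \<ge> 7"
  defines "n \<equiv> triangular s + 7"
  shows "max_deg_partitions n = (\<lambda>(F, E). staircase_partition s F E) ` extremal_pairs"
proof -
  let ?P = "\<lambda>(F, E). staircase_partition s F E"
  \<comment> \<open>This is \<open>s * (s - 1) + 4\<close>; the truncated subtraction is exact
    because \<open>s \<le> s * s\<close>.\<close>
  let ?d = "s * s + 4 - s"
  have sq: "s \<le> s * s" by simp
  have extremal: "?P p \<in> partitions n \<and> deg n (?P p) = ?d" if mem: "p \<in> extremal_pairs" for p
  proof -
    obtain F E where p: "p = (F, E)" "(F, E) \<in> extremal_pairs" using mem by (metis surj_pair)
    note props = extremal_pairs_props[OF p(2) assms(1)]
    note stats = staircase_partition_stats[OF props(1,2)]
    have "triangular s + sum_mset F + sum_mset E = n" using props(4) by (simp add: n_def)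
    then show ?thesis using stats(2,5) props(5) p(1) by auto
  qed
  have bound: "deg n \<nu> \<le> ?d \<and> (deg n \<nu> = ?d \<longrightarrow> \<nu> \<in> ?P ` extremal_pairs)"
    if \<nu>: "\<nu> \<in> partitions n" for \<nu>
  proof -
    have nz: "0 \<notin># \<nu>" and sum: "sum_mset \<nu> = n" using \<nu> by (auto simp: partitions_def)
    let ?r = "card (set_mset \<nu>)"
    have "triangular ?r < triangular (Suc s)"
      using triangular_card_le_sum_mset[OF nz] sum less_triangular_Suc[OF assms(1)]
      by (simp add: n_def)
    then have "?r \<le> s" using triangular_mono[of "Suc s" ?r] by (meson not_less not_less_eq_eq)
    then consider "?r < s" | "?r = s" by linarith
    then show ?thesis
    proof cases
      case 1
      have "A_stat \<nu> \<le> ?r" "B_stat \<nu> \<le> ?r"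
        unfolding A_stat_eq[OF nz] B_stat_eq by (auto intro!: card_mono)
      then have "deg n \<nu> \<le> ?r * (?r + 1)" using deg_formula[OF \<nu>] by simp
      also have "\<dots> \<le> (s - 1) * s" using 1 by (intro mult_le_mono) auto
      also have "\<dots> = s * s - s" by (simp add: diff_mult_distrib)
      also have "\<dots> < ?d" using sq by linarith
      finally show ?thesis by simp
    next
      case 2
      obtain F E where FE: "set_mset F \<subseteq> {1..s}" "set_mset E \<subseteq> staircase s F"
          "\<nu> = staircase_partition s F E"
        using staircase_partition_exhaust[OF nz 2] by blast
      note stats = staircase_partition_stats[OF FE(1,2), folded FE(3)]
      have nz': "0 \<notin># F" "0 \<notin># E" using FE(1,2) zero_notin_staircase by auto
      have n_eq: "triangular s + sum_mset F + sum_mset E = n"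
        using stats(2) sum by (simp add: partitions_def)
      have d: "deg n \<nu> + s = s * s + card (set_mset F) + card (set_mset E)"
        using stats(5) unfolding n_eq .
      have seven: "sum_mset F + sum_mset E = 7" using n_eq by (simp add: n_def)
      note ex = extremal_pairs_exhaust[OF nz' seven]
      have le: "deg n \<nu> \<le> ?d" using d ex(1) by linarith
      moreover have "\<nu> \<in> ?P ` extremal_pairs" if "deg n \<nu> = ?d"
      proof -
        have "card (set_mset F) + card (set_mset E) = 4" using d that sq by linarith
        then show ?thesis using ex(2) FE(3) by force
      qed
      ultimately show ?thesis by blast
    qed
  qed
  have "max_deg n = ?d"
    unfolding max_deg_def
  proof (rule Max_eqI)
    show le: "y \<le> ?d" if "y \<in> deg n ` partitions n" for y using that bound by blast
    then have "deg n ` partitions n \<subseteq> {..?d}" by blast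
    then show "finite (deg n ` partitions n)" by (rule finite_subset) simp
    have "({#1, 2, 3#}, {#1#}) \<in> extremal_pairs" by (simp add: extremal_pairs_def)
    note extremal[OF this]
    then show "?d \<in> deg n ` partitions n" by (metis imageI)
  qed
  then have "max_deg_partitions n = {\<nu> \<in> partitions n. deg n \<nu> = ?d}"
    by (simp only: max_deg_partitions_def)
  also have "\<dots> = ?P ` extremal_pairs"
    using bound extremal by (intro subset_antisym subsetI) blast+
  finally show ?thesis .
qed

text \<open>The set of parts is the staircase, and cancelling it recovers \<open>E\<close>. Only
  \<open>F = {#1, 3#}\<close> and \<open>F = {#1, 1, 2#}\<close> share an \<open>E\<close>, and
  their sizes differ.\<close>

lemma inj_on_staircase_partition:
  assumes "s \<ge> 7"
  shows "inj_on (\<lambda>(F, E). staircase_partition s F E) extremal_pairs"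
proof (rule inj_onI, clarify)
  fix F E F' E'
  assume FE: "(F, E) \<in> extremal_pairs" "(F', E') \<in> extremal_pairs"
    and eq: "staircase_partition s F E = staircase_partition s F' E'"
  note props = extremal_pairs_props[OF FE(1) assms] and props' = extremal_pairs_props[OF FE(2) assms]
  have st: "staircase s F = staircase s F'"
    using staircase_partition_stats(1)[OF props(1,2)] staircase_partition_stats(1)[OF props'(1,2)] eq
    by simp
  then have E: "E = E'" using eq by (simp add: staircase_partition_def)
  \<comment> \<open>Every column crosses the first row, so the largest part reveals the number of
    columns.\<close>
  have max_row: "Max (staircase s M) = s + size M" if "0 \<notin># M" for M
  proof (rule Max_eqI)
    have "{#f \<in># M. 1 \<le> f#} = M" using that by (auto simp: filter_mset_eq_conv Suc_le_eq intro: gr0I)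
    then have top: "row s M 1 = s + size M" by (simp add: row_def)
    then show "s + size M \<in> staircase s M" using assms by (force simp: staircase_def)
    fix y assume "y \<in> staircase s M"
    then obtain i where "i \<in> {1..s}" "y = row s M i" by (auto simp: staircase_def)
    then show "y \<le> s + size M"
      using row_less[of 1 i s M] top by (cases "i = 1") auto
  qed simp
  have "size F = size F'" using max_row[OF props(3)] max_row[OF props'(3)] st by simp
  moreover have "sum_mset F = sum_mset F'" using props(4) props'(4) E by simp
  ultimately show "F = F' \<and> E = E'"
    using FE E by (auto simp: extremal_pairs_def)
qed

lemma card_extremal_pairs: "card extremal_pairs = 6"
  by (simp add: extremal_pairs_def)

section \<open>Conjugation\<close>

text \<open>A necessary condition that is easy to refute: column lengths are the parts of the
  conjugate, so they must recur among the rows.\<close>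

lemma column_in_self_conjugate:
  assumes "conjugate \<nu> = \<nu>" "1 \<le> j" "x \<in># \<nu>" "j \<le> x"
  shows "size {#y \<in># \<nu>. j \<le> y#} \<in># \<nu>"
proof -
  have "j \<in> (\<Union>x\<in>set_mset \<nu>. {1..x})" using assms(2-4) by auto
  then have "size {#y \<in># \<nu>. j \<le> y#} \<in># conjugate \<nu>"
    unfolding conjugate_def by simp
  then show ?thesis by (simp add: assms(1))
qed

text \<open>The length of the first or of the third column is not a part.\<close>

lemma extremal_not_self_conjugate:
  assumes "(F, E) \<in> extremal_pairs" "s \<ge> 7"
  shows "conjugate (staircase_partition s F E) \<noteq> staircase_partition s F E"
proof
  assume sc: "conjugate (staircase_partition s F E) = staircase_partition s F E"
  note props = extremal_pairs_props[OF assms]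
  note set = staircase_partition_stats(1)[OF props(1,2)]
  have col: "s + 1 - j + size {#y \<in># E. j \<le> y#} \<in> staircase s F" if j: "j \<in> {1, 3}" for j
  proof -
    \<comment> \<open>Only the sizes \<open>1, ..., j - 1\<close> fall short of \<open>j\<close>, so
      the staircase contributes \<open>s + 1 - j\<close> to column \<open>j\<close>.\<close>
    have "{x \<in> staircase s F. j \<le> x} = staircase s F - {1..<j}"
      using zero_notin_staircase[of s F] by (auto simp: Suc_le_eq not_le intro: gr0I)
    moreover have "{1..<j} \<subseteq> staircase s F"
      using props(6) assms(2) j by (auto simp: subset_iff)
    ultimately have "card {x \<in> staircase s F. j \<le> x} = s - (j - 1)"
      by (simp add: card_Diff_subset card_staircase)
    then have "size {#y \<in># staircase_partition s F E. j \<le> y#} = s + 1 - j + size {#y \<in># E. j \<le> y#}"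
      using j by (auto simp: staircase_partition_def filter_mset_mset_set)
    moreover have "j \<in># staircase_partition s F E"
      using props(6) assms(2) j by (auto simp: set subset_iff)
    ultimately show ?thesis
      using column_in_self_conjugate[OF sc, of j j] j by (auto simp: set)
  qed
  \<comment> \<open>Both column lengths exceed \<open>s - 3\<close>, so they could only match one of
    the top three rows.\<close>
  have "s + size {#y \<in># E. 1 \<le> y#} \<in> row s F ` {1, 2, 3}"
    using col[of 1] props(7) assms(2) by fastforce
  moreover have "s - 2 + size {#y \<in># E. 3 \<le> y#} \<in> row s F ` {1, 2, 3}"
    using col[of 3] props(7) assms(2) by fastforce
  \<comment> \<open>Column 1 fails for \<open>E = {#1, 1, 2#}\<close>,
    \<open>E = {#1, 2, 3#}\<close> and \<open>F = {#1, 1, 2#}\<close>; column 3 fails for the other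
    three pairs.\<close>
  ultimately show False
    using assms by (auto simp: extremal_pairs_def row_def)
qed

theorem proposition7p5:
  fixes s :: nat
  assumes "s \<ge> 7"
  shows "AB_pairs (triangular s + 7) = {(3, 1), (2, 2), (1, 3)}
    \<and> card (max_deg_partitions_AB (triangular s + 7) (3, 1)) = 1
    \<and> card (max_deg_partitions_AB (triangular s + 7) (2, 2)) = 4
    \<and> card (max_deg_partitions_AB (triangular s + 7) (1, 3)) = 1
    \<and> card (max_deg_partitions (triangular s + 7)) = 6
    \<and> num_self_conjugate (triangular s + 7) = 0"
proof -
  let ?P = "\<lambda>(F, E). staircase_partition s F E"
  let ?AB = "\<lambda>(F, E). (card (set_mset F), card (set_mset E))"
  note M = max_degree_classification[OF assms] and inj = inj_on_staircase_partition[OF assms]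
  have AB: "(A_stat (?P p), B_stat (?P p)) = ?AB p" if "p \<in> extremal_pairs" for p
    using that staircase_partition_stats(3,4) extremal_pairs_props(1,2) assms by (cases p) auto
  \<comment> \<open>Injectivity reduces each count of partitions to a count among the six
    pairs.\<close>
  have count: "card (max_deg_partitions_AB (triangular s + 7) ab) =
      card {p \<in> extremal_pairs. ?AB p = ab}" for ab
  proof -
    have "max_deg_partitions_AB (triangular s + 7) ab = ?P ` {p \<in> extremal_pairs. ?AB p = ab}"
      unfolding max_deg_partitions_AB_def M using AB by (auto simp del: split_paired_All)
    then show ?thesis
      using card_image[OF inj_on_subset[OF inj]] by (metis (no_types, lifting) mem_Collect_eq subsetI)
  qed
  have "{p \<in> extremal_pairs. ?AB p = (3, 1)} = {({#1, 2, 3#}, {#1#})}"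
    by (auto simp: extremal_pairs_def)
  moreover have "{p \<in> extremal_pairs. ?AB p = (2, 2)} =
      {({#1, 2#}, {#1, 3#}), ({#1, 2#}, {#1, 1, 2#}), ({#1, 3#}, {#1, 2#}), ({#1, 1, 2#}, {#1, 2#})}"
    by (auto simp: extremal_pairs_def)
  moreover have "{p \<in> extremal_pairs. ?AB p = (1, 3)} = {({#1#}, {#1, 2, 3#})}"
    by (auto simp: extremal_pairs_def)
  moreover have "?AB ` extremal_pairs = {(3, 1), (2, 2), (1, 3)}"
    by (simp add: extremal_pairs_def numeral_eq_Suc)
  moreover have "AB_pairs (triangular s + 7) = ?AB ` extremal_pairs"
    unfolding AB_pairs_def M image_image using AB by (rule image_cong[OF refl])
  moreover have "card (max_deg_partitions (triangular s + 7)) = 6"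
    unfolding M card_image[OF inj] by (rule card_extremal_pairs)
  moreover have "{\<nu> \<in> max_deg_partitions (triangular s + 7). conjugate \<nu> = \<nu>} = {}"
    unfolding M using extremal_not_self_conjugate assms by auto
  then have "num_self_conjugate (triangular s + 7) = 0"
    unfolding num_self_conjugate_def by (simp only: card.empty)
  ultimately show ?thesis by (simp add: count)
qed

end
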